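(* Let $n\ge2$, let $\mathcal{O}=\overline{B_1(0)}\subset\mathbb{R}^n$ be the closed unit ball, let $k_0\in\mathbb{R}^n\setminus\mathcal{O}$, and let $d:\overline{\mathbb{R}^n\setminus\mathcal{O}}\to[0,+\infty[$ be the (Euclidean) distance function from $k_0$ in the presence of the obstacle $\mathcal{O}$. Let $S(k_0)=\{x\in\overline{\mathbb{R}^n\setminus\mathcal{O}} : |x-k_0|<d(x)\}$. Then: (i) $d\notin SC^1\big(\overline{B_\delta(x)\setminus\mathcal{O}}\big)$ for every $x\in S(k_0)\cap\partial\mathcal{O}$ and every $\delta>0$. (ii) For $\alpha\in]0,1]$, if $d\in SC^\alpha_{loc}\big(\overline{\mathbb{R}^n\setminus\mathcal{O}}\setminus\{k_0\}\big)$, then $\alpha\le\frac12$.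
   Context: Distance function (case $A\equiv I$): let $\Gamma$ be the set of all (locally) absolutely continuous curves $\gamma:[0,+\infty[\to\overline{\mathbb{R}^n\setminus\mathcal{O}}$ with $|\dot\gamma(t)|\le 1$ for a.e. $t\ge0$. For $x\in\overline{\mathbb{R}^n\setminus\mathcal{O}}$ let $\Gamma[x]=\{\gamma\in\Gamma : \gamma(0)=x\}$, and let $\tau(\gamma)=\inf\{t\ge0 : \gamma(t)=k_0\}\in[0,+\infty]$. Then $d(x)=\inf_{\gamma\in\Gamma[x]}\tau(\gamma)$. Fractional semiconcavity: given a set $U\subset\mathbb{R}^n$ and $\alpha\in]0,1]$, $SC^\alpha(U)$ is the set of all $u:U\to\mathbb{R}$ that are locally Lipschitz continuous on $U$ and for which there exists $C>0$ such that $$\lambda u(x)+(1-\lambda)u(y)-u(\lambda x+(1-\lambda)y)\le C\lambda(1-\lambda)|x-y|^{1+\alpha}$$ for all $x,y\in U$ such that the segment $[x,y]$ is contained in $U$ and all $\lambda\in[0,1]$. $SC^\alpha_{loc}(U)$ is the local version: $u|_K\in SC^\alpha(K)$ for every compact $K\subset U$, with constant depending on $K$. *)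

theory Defs
  imports "HOL-Analysis.Analysis"
begin

text \<open>The usual epsilon-delta notion for a function on an interval \<open>S\<close>: \<open>\<D>\<close> is a finite family of
  non-overlapping compact intervals \<open>[Inf K, Sup K]\<close> contained in \<open>S\<close>, with union \<open>t\<close>.\<close>

definition absolutely_continuous_on :: "real set \<Rightarrow> (real \<Rightarrow> 'a::real_normed_vector) \<Rightarrow> bool"
  where "absolutely_continuous_on S f \<longleftrightarrow>
    (\<forall>\<epsilon>>0. \<exists>\<delta>>0. \<forall>\<D> t. \<D> division_of t \<and> t \<subseteq> S \<and> (\<Sum>K\<in>\<D>. Sup K - Inf K) < \<delta>
      \<longrightarrow> (\<Sum>K\<in>\<D>. norm (f (Sup K) - f (Inf K))) < \<epsilon>)"

text \<open>A curve on \<open>[0,+\<infinity>[\<close> is represented by a function on the whole line; its values at negative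
  arguments play no role in any of the definitions below.\<close>

definition locally_absolutely_continuous :: "(real \<Rightarrow> 'a::real_normed_vector) \<Rightarrow> bool"
  where "locally_absolutely_continuous \<gamma> \<longleftrightarrow> (\<forall>T\<ge>0. absolutely_continuous_on {0..T} \<gamma>)"

definition free_region :: "'a::real_normed_vector set \<Rightarrow> 'a set"
  where "free_region Obs = closure (UNIV - Obs)"

definition admissible_curves :: "'a::real_normed_vector set \<Rightarrow> (real \<Rightarrow> 'a) set"
  where "admissible_curves Obs = {\<gamma>.
    (\<forall>t\<ge>0. \<gamma> t \<in> free_region Obs) \<and>
    locally_absolutely_continuous \<gamma> \<and>
    (AE t in lebesgue. t \<ge> 0 \<longrightarrow>
      (\<exists>v. (\<gamma> has_vector_derivative v) (at t within {0..}) \<and> norm v \<le> 1))}"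

definition admissible_curves_from :: "'a::real_normed_vector set \<Rightarrow> 'a \<Rightarrow> (real \<Rightarrow> 'a) set"
  where "admissible_curves_from Obs x = {\<gamma> \<in> admissible_curves Obs. \<gamma> 0 = x}"

definition hitting_time :: "'a \<Rightarrow> (real \<Rightarrow> 'a) \<Rightarrow> ereal"
  where "hitting_time k0 \<gamma> = (INF t\<in>{t. t \<ge> 0 \<and> \<gamma> t = k0}. ereal t)"

text \<open>The infimum is taken in the extended reals (with value \<open>\<infinity>\<close> if \<open>k0\<close> is never reached). It is a
  finite nonnegative number when \<open>k0\<close> and \<open>x\<close> are joined by a rectifiable path in the free region, in
  particular for a ball in dimension at least two and all \<open>k0\<close> and \<open>x\<close> in the free region.\<close>

definition obstacle_dist :: "'a::real_normed_vector set \<Rightarrow> 'a \<Rightarrow> 'a \<Rightarrow> real"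
  where "obstacle_dist Obs k0 x =
    real_of_ereal (INF \<gamma>\<in>admissible_curves_from Obs x. hitting_time k0 \<gamma>)"

definition shadow :: "'a::real_normed_vector set \<Rightarrow> 'a \<Rightarrow> 'a set"
  where "shadow Obs k0 = {x \<in> free_region Obs. norm (x - k0) < obstacle_dist Obs k0 x}"

definition locally_lipschitz_on :: "'a::metric_space set \<Rightarrow> ('a \<Rightarrow> 'b::metric_space) \<Rightarrow> bool"
  where "locally_lipschitz_on U u \<longleftrightarrow>
    (\<forall>x\<in>U. \<exists>r>0. \<exists>L. L-lipschitz_on (cball x r \<inter> U) u)"

text \<open>A function on \<open>U\<close> is represented by a function on the whole space; membership depends only on
  its restriction to \<open>U\<close>.\<close>

definition SC :: "real \<Rightarrow> 'a::real_normed_vector set \<Rightarrow> ('a \<Rightarrow> real) set"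
  where "SC \<alpha> U = {u. locally_lipschitz_on U u \<and>
    (\<exists>C>0. \<forall>x\<in>U. \<forall>y\<in>U. closed_segment x y \<subseteq> U \<longrightarrow> (\<forall>s\<in>{0..1}.
      s * u x + (1 - s) * u y - u (s *\<^sub>R x + (1 - s) *\<^sub>R y)
        \<le> C * s * (1 - s) * norm (x - y) powr (1 + \<alpha>)))}"

definition SC_loc :: "real \<Rightarrow> 'a::real_normed_vector set \<Rightarrow> ('a \<Rightarrow> real) set"
  where "SC_loc \<alpha> U = {u. \<forall>K. compact K \<and> K \<subseteq> U \<longrightarrow> u \<in> SC \<alpha> K}"

end

(* Let k0 = k e with e a unit vector, and let x be a unit vector at angle theta from e, invisible
   from k0, i.e. with theta > beta where k cos(beta) = 1. The shortest path from r x to k0 follows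
   a tangent line, an arc of the unit circle and a second tangent line, which gives
     d((1 + s) x) = w - arctan w + const,   w = sqrt((1 + s)^2 - 1),
   for small s >= 0. As w - arctan w ~ (2 s)^(3/2) / 3, the second difference
   d(x) + d((1 + 2 t) x) - 2 d((1 + t) x) is of exact order t^(3/2), which contradicts SC^alpha on
   the segment as soon as alpha > 1/2.

   That no path is shorter: rotate it into a half plane bounded by the axis R e. There it has to
   cross all rays from the origin between the angles theta - arctan w and beta, and passing from
   outside the disc across an angle D takes at least time sin D; divide the angle into ever
   smaller pieces. *)

theory Submission
  imports Defs "HOL-Real_Asymp.Real_Asymp"
begin

section \<open>Absolutely continuous curves\<close>

lemma absolutely_continuous_on_subset:
  "absolutely_continuous_on S f \<Longrightarrow> T \<subseteq> S \<Longrightarrow> absolutely_continuous_on T f"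
  unfolding absolutely_continuous_on_def by (meson order_trans)

text \<open>The tag \<open>t\<close> lies between \<open>x\<close> and \<open>y\<close>, so the
  errors on its two sides are at most \<epsilon> times \<open>t - x\<close> and
  \<open>y - t\<close>, and these lengths add up to \<open>y - x\<close>.\<close>

lemma vector_derivative_fine_bound:
  fixes f :: "real \<Rightarrow> 'a::real_normed_vector"
  assumes "(f has_vector_derivative v) (at t within S)" "norm v \<le> 1" "\<epsilon> > 0"
  obtains r where "r > 0"
    "\<And>x y. x \<in> S \<Longrightarrow> y \<in> S \<Longrightarrow> x \<le> t \<Longrightarrow> t \<le> y \<Longrightarrow> {x, y} \<subseteq> ball t r \<Longrightarrow>
      norm (f y - f x) \<le> (1 + \<epsilon>) * (y - x)"
proof -
  obtain r where "r > 0" and r: "\<And>y. y \<in> S \<Longrightarrow> norm (y - t) < r \<Longrightarrow>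
      norm (f y - f t - (y - t) *\<^sub>R v) \<le> \<epsilon> * norm (y - t)"
    using assms(1,3) unfolding has_vector_derivative_def has_derivative_within_alt by meson
  have near: "norm (f y - f t) \<le> (1 + \<epsilon>) * \<bar>y - t\<bar>" if "y \<in> S" "y \<in> ball t r" for y
  proof -
    have "norm (f y - f t) \<le> norm (f y - f t - (y - t) *\<^sub>R v) + norm ((y - t) *\<^sub>R v)"
      by (metis diff_add_cancel norm_triangle_ineq)
    also have "\<dots> \<le> \<epsilon> * \<bar>y - t\<bar> + \<bar>y - t\<bar> * 1"
      using r[of y] that assms(2)
      by (intro add_mono) (auto simp: dist_real_def abs_minus_commute intro!: mult_left_le)
    finally show ?thesis by (simp add: algebra_simps)
  qed
  show ?thesis
  proof (rule that[OF \<open>r > 0\<close>])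
    fix x y assume xy: "x \<in> S" "y \<in> S" "x \<le> t" "t \<le> y" "{x, y} \<subseteq> ball t r"
    have "norm (f y - f x) \<le> norm (f y - f t) + norm (f x - f t)"
      by (metis dist_norm dist_triangle2)
    also have "\<dots> \<le> (1 + \<epsilon>) * (y - t) + (1 + \<epsilon>) * (t - x)"
      using near[of x] near[of y] xy by (intro add_mono) (auto simp: abs_if split: if_splits)
    finally show "norm (f y - f x) \<le> (1 + \<epsilon>) * (y - x)"
      by (simp add: algebra_simps)
  qed
qed

text \<open>Take a fine tagged division. At tags outside the exceptional null set the increments are
  controlled by the derivative; the other intervals lie in an open set of small measure, where
  absolute continuity applies.\<close>

lemma absolutely_continuous_norm_diff_le:
  fixes f :: "real \<Rightarrow> 'a::real_normed_vector"
  assumes "a \<le> b" and ac: "absolutely_continuous_on {a..b} f"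
    and deriv: "AE t in lebesgue. t \<in> {a..b} \<longrightarrow>
      (\<exists>v. (f has_vector_derivative v) (at t within {a..b}) \<and> norm v \<le> 1)"
  shows "norm (f b - f a) \<le> b - a"
proof -
  have bound: "norm (f b - f a) \<le> (1 + \<epsilon>) * (b - a) + \<epsilon>" if "\<epsilon> > 0" for \<epsilon>
  proof -
    obtain \<delta> where "\<delta> > 0" and \<delta>: "\<And>\<D> t. \<D> division_of t \<Longrightarrow> t \<subseteq> {a..b} \<Longrightarrow>
        (\<Sum>K\<in>\<D>. Sup K - Inf K) < \<delta> \<Longrightarrow> (\<Sum>K\<in>\<D>. norm (f (Sup K) - f (Inf K))) < \<epsilon>"
      using ac \<open>\<epsilon> > 0\<close> unfolding absolutely_continuous_on_def by meson
    obtain N where bad: "{t \<in> space lebesgue. \<not> (t \<in> {a..b} \<longrightarrow>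
        (\<exists>v. (f has_vector_derivative v) (at t within {a..b}) \<and> norm v \<le> 1))} \<subseteq> N"
      and N0: "emeasure lebesgue N = 0" "N \<in> sets lebesgue"
      using deriv by (elim AE_E)
    \<comment> \<open>As \<open>N\<close> is null, \<open>U\<close> itself has measure below
      \<delta>. This open set will catch the intervals tagged in \<open>N\<close>.\<close>
    obtain U where U: "open U" "N \<subseteq> U" "(U - N) \<in> lmeasurable" "emeasure lebesgue (U - N) < ennreal \<delta>"
      using sets_lebesgue_outer_open[OF N0(2) \<open>\<delta> > 0\<close>] by blast
    have Usets: "U \<in> sets lebesgue" using U(1) by auto
    have eqU: "emeasure lebesgue U = emeasure lebesgue (U - N)"
      using N0 Usets by (simp add: emeasure_Diff_null_set null_setsI)
    have Ulm: "U \<in> lmeasurable" 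
      using eqU U(4) Usets by (intro fmeasurableI) (auto simp: top.not_eq_extremum intro: order.strict_trans)
    have Um: "measure lebesgue U < \<delta>"
      using U(4) Ulm unfolding eqU[symmetric] by (simp add: emeasure_eq_measure2 ennreal_less_iff)
    have "\<exists>r>0. \<forall>x y. x \<in> {a..b} \<longrightarrow> y \<in> {a..b} \<longrightarrow> x \<le> t \<longrightarrow> t \<le> y \<longrightarrow> {x, y} \<subseteq> ball t r \<longrightarrow>
      norm (f y - f x) \<le> (1 + \<epsilon>) * (y - x)" if "t \<notin> N" "t \<in> {a..b}" for t
    proof -
      have "\<exists>v. (f has_vector_derivative v) (at t within {a..b}) \<and> norm v \<le> 1"
        using subsetD[OF bad, of t] that by auto
      then obtain v where "(f has_vector_derivative v) (at t within {a..b})" "norm v \<le> 1"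
        by blast
      from vector_derivative_fine_bound[OF this \<open>\<epsilon> > 0\<close>] show ?thesis by metis
    qed
    then obtain r where r: "\<And>t. t \<notin> N \<Longrightarrow> t \<in> {a..b} \<Longrightarrow> r t > 0 \<and> (\<forall>x y. x \<in> {a..b} \<longrightarrow> y \<in> {a..b} \<longrightarrow>
        x \<le> t \<longrightarrow> t \<le> y \<longrightarrow> {x, y} \<subseteq> ball t (r t) \<longrightarrow> norm (f y - f x) \<le> (1 + \<epsilon>) * (y - x))"
      by metis
    \<comment> \<open>The gauge forces intervals tagged in \<open>N\<close> into \<open>U\<close>
      and the other ones into the range of the derivative bound. Radius 1 is a default outside
      \<open>{a..b}\<close>, so that \<open>G\<close> is a gauge on the whole line.\<close>
    define G where "G t = (if t \<in> N then U else ball t (if t \<in> {a..b} then r t else 1))" for t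
    have "gauge G"
      unfolding gauge_def G_def using U(1,2) r by auto
    then obtain p where p: "p tagged_division_of {a..b}" "G fine p"
      by (rule fine_division_exists_real)
    note finp = tagged_division_of_finite[OF p(1)]
    have interval: "\<exists>u v. K = {u..v} \<and> a \<le> u \<and> u \<le> t \<and> t \<le> v \<and> v \<le> b" if tK: "(t, K) \<in> p" for t K
    proof -
      obtain u v where "K = {u..v}" "t \<in> K" "K \<subseteq> {a..b}"
        using tagged_division_ofD(2,3,4)[OF p(1) tK] by (metis box_real(2))
      then show ?thesis by (intro exI[of _ u] exI[of _ v]) auto
    qed
    define p1 where "p1 = {(t, K) \<in> p. t \<in> N}"
    define p2 where "p2 = {(t, K) \<in> p. t \<notin> N}"
    have split: "p = p1 \<union> p2" "p1 \<inter> p2 = {}" "p1 \<subseteq> p" "p2 \<subseteq> p"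
      by (auto simp: p1_def p2_def)
    have fin12: "finite p1" "finite p2" using finp split by (auto intro: finite_subset)
    have "f b - f a = (\<Sum>(t, K)\<in>p. f (Sup K) - f (Inf K))"
      by (rule additive_tagged_division_1[OF \<open>a \<le> b\<close> p(1), symmetric])
    also have "norm \<dots> \<le> (\<Sum>(t, K)\<in>p. norm (f (Sup K) - f (Inf K)))"
      by (rule sum_norm_le) auto
    also have "\<dots> = (\<Sum>(t, K)\<in>p1. norm (f (Sup K) - f (Inf K))) + (\<Sum>(t, K)\<in>p2. norm (f (Sup K) - f (Inf K)))"
      using fin12 split by (subst split(1)) (rule sum.union_disjoint)
    also have "\<dots> \<le> \<epsilon> + (1 + \<epsilon>) * (b - a)"
    proof (rule add_mono)
      define \<D> where "\<D> = snd ` p1"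
      have "p1 tagged_partial_division_of {a..b}"
        using p(1) split(3) by (meson tagged_division_of_def tagged_partial_division_subset)
      then have p1: "p1 tagged_division_of \<Union>\<D>"
        unfolding \<D>_def by (rule tagged_partial_division_of_Union_self)
      have \<D>: "\<D> division_of \<Union>\<D>"
        using division_of_tagged_division[OF p1] by (simp add: \<D>_def)
      have sub: "\<Union>\<D> \<subseteq> {a..b}" "\<Union>\<D> \<subseteq> U"
        using tagged_division_ofD(3)[OF p(1)] fineD[OF p(2)]
        by (fastforce simp: \<D>_def p1_def G_def)+
      have "(\<Sum>K\<in>\<D>. Sup K - Inf K) = (\<Sum>K\<in>\<D>. measure lebesgue K)"
      proof (rule sum.cong)
        fix K assume "K \<in> \<D>"
        then obtain t where "(t, K) \<in> p" by (auto simp: \<D>_def p1_def)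
        from interval[OF this] show "Sup K - Inf K = measure lebesgue K" by auto
      qed simp
      also have "\<dots> = measure lebesgue (\<Union>\<D>)" by (rule content_division[OF \<D>])
      also have "\<dots> \<le> measure lebesgue U"
        using sub Ulm lmeasurable_division[OF \<D>] by (intro measure_mono_fmeasurable) auto
      finally have "(\<Sum>K\<in>\<D>. Sup K - Inf K) < \<delta>" using Um by simp
      from \<delta>[OF \<D> sub(1) this] have "(\<Sum>K\<in>\<D>. norm (f (Sup K) - f (Inf K))) \<le> \<epsilon>" by simp
      \<comment> \<open>Distinct tags may share a degenerate interval, so the sums over tags and
        over intervals agree only because such terms vanish. On the empty set, where the increment
        need not vanish, \<open>h\<close> is set to 0.\<close>
      moreover define h where "h K = (if K = {} then 0 else norm (f (Sup K) - f (Inf K)))" for K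
      have "(\<Sum>(t, K)\<in>p1. h K) = (\<Sum>K\<in>\<D>. h K)"
        unfolding \<D>_def
      proof (rule sum.over_tagged_division_lemma[OF p1])
        fix u v :: real assume "box u v = {}"
        then show "h (cbox u v) = 0"
          by (cases "u = v") (auto simp: h_def)
      qed
      moreover have "h K = norm (f (Sup K) - f (Inf K))" if "(t, K) \<in> p1" for t K
        using tagged_division_ofD(2)[OF p1 that] by (auto simp: h_def)
      then have "(\<Sum>(t, K)\<in>p1. h K) = (\<Sum>(t, K)\<in>p1. norm (f (Sup K) - f (Inf K)))"
        "(\<Sum>K\<in>\<D>. h K) = (\<Sum>K\<in>\<D>. norm (f (Sup K) - f (Inf K)))"
        by (auto simp: \<D>_def intro!: sum.cong)
      ultimately show "(\<Sum>(t, K)\<in>p1. norm (f (Sup K) - f (Inf K))) \<le> \<epsilon>" by simp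
    next
      have "(\<Sum>(t, K)\<in>p2. norm (f (Sup K) - f (Inf K))) \<le> (\<Sum>(t, K)\<in>p2. (1 + \<epsilon>) * (Sup K - Inf K))"
      proof (rule sum_mono, clarify)
        fix t K assume tK: "(t, K) \<in> p2"
        then have *: "(t, K) \<in> p" "t \<notin> N" by (auto simp: p2_def)
        obtain u v where uv: "K = {u..v}" "a \<le> u" "u \<le> t" "t \<le> v" "v \<le> b"
          using interval[OF *(1)] by blast
        have "K \<subseteq> ball t (r t)"
          using fineD[OF p(2) *(1)] * uv by (auto simp: G_def)
        moreover have "{u, v} \<subseteq> K" using uv by auto
        ultimately have "{u, v} \<subseteq> ball t (r t)" by (rule subset_trans[rotated])
        then show "norm (f (Sup K) - f (Inf K)) \<le> (1 + \<epsilon>) * (Sup K - Inf K)"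
          using r[of t] * uv by auto
      qed
      also have "\<dots> \<le> (\<Sum>(t, K)\<in>p. (1 + \<epsilon>) * (Sup K - Inf K))"
        using finp split(4) \<open>\<epsilon> > 0\<close> by (intro sum_mono2) (auto dest!: interval)
      also have "\<dots> = (1 + \<epsilon>) * (\<Sum>(t, K)\<in>p. Sup K - Inf K)"
        by (simp add: sum_distrib_left case_prod_beta)
      also have "(\<Sum>(t, K)\<in>p. Sup K - Inf K) = b - a"
        using additive_tagged_division_1[OF \<open>a \<le> b\<close> p(1), of "\<lambda>x. x"] by simp
      finally show "(\<Sum>(t, K)\<in>p2. norm (f (Sup K) - f (Inf K))) \<le> (1 + \<epsilon>) * (b - a)" .
    qed
    finally show ?thesis by simp
  qed
  have "((\<lambda>\<epsilon>. (1 + \<epsilon>) * (b - a) + \<epsilon>) \<longlongrightarrow> (1 + 0) * (b - a) + 0) (at_right 0)"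
    by (intro tendsto_intros)
  moreover have "\<forall>\<^sub>F \<epsilon> in at_right 0. norm (f b - f a) \<le> (1 + \<epsilon>) * (b - a) + \<epsilon>"
    using bound by (auto simp: eventually_at_right_less intro: eventually_at_right_less[THEN eventually_mono])
  ultimately show ?thesis
    by (intro tendsto_lowerbound[where F = "at_right 0"]) auto
qed

text \<open>Together with staying in the free region, this is all that the lower bound uses of an
  admissible curve.\<close>

lemma admissible_curve_norm_diff_le:
  assumes "\<gamma> \<in> admissible_curves Obs" "0 \<le> s" "s \<le> t"
  shows "norm (\<gamma> t - \<gamma> s) \<le> t - s"
proof (rule absolutely_continuous_norm_diff_le[OF \<open>s \<le> t\<close>])
  have "absolutely_continuous_on {0..t} \<gamma>"
    using assms by (auto simp: admissible_curves_def locally_absolutely_continuous_def)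
  then show "absolutely_continuous_on {s..t} \<gamma>"
    by (rule absolutely_continuous_on_subset) (use assms in auto)
  have "AE u in lebesgue. u \<ge> 0 \<longrightarrow> (\<exists>v. (\<gamma> has_vector_derivative v) (at u within {0..}) \<and> norm v \<le> 1)"
    using assms by (simp add: admissible_curves_def)
  then show "AE u in lebesgue. u \<in> {s..t} \<longrightarrow>
      (\<exists>v. (\<gamma> has_vector_derivative v) (at u within {s..t}) \<and> norm v \<le> 1)"
  proof eventually_elim
    case (elim u)
    have "{s..t} \<subseteq> {0..}" using assms by auto
    with elim show ?case
      using assms by (metis atLeastAtMost_iff has_vector_derivative_within_subset order_trans)
  qed
qed

section \<open>Lower bound for the travel time around the unit ball\<close>

text \<open>The coordinates of \<open>p\<close> in the half plane obtained by rotating about the axis \<open>e\<close> are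
  \<open>(p \<bullet> e, norm (p - (p \<bullet> e) e))\<close>. The ray at angle \<open>\<alpha>\<close> and the signed distance to its line are
  read in this half plane.\<close>

definition on_ray :: "'a::real_inner \<Rightarrow> real \<Rightarrow> real \<Rightarrow> 'a \<Rightarrow> bool"
  where "on_ray e \<alpha> r p \<longleftrightarrow> p \<bullet> e = r * cos \<alpha> \<and> norm (p - (p \<bullet> e) *\<^sub>R e) = r * sin \<alpha>"

definition height :: "'a::real_inner \<Rightarrow> real \<Rightarrow> 'a \<Rightarrow> real"
  where "height e \<alpha> p = norm (p - (p \<bullet> e) *\<^sub>R e) * cos \<alpha> - (p \<bullet> e) * sin \<alpha>"

lemma norm_squared_axis:
  assumes "norm e = 1"
  shows "(norm p)\<^sup>2 = (p \<bullet> e)\<^sup>2 + (norm (p - (p \<bullet> e) *\<^sub>R e))\<^sup>2"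
proof -
  have "e \<bullet> e = 1" using assms by (simp add: dot_square_norm)
  then show ?thesis
    unfolding power2_norm_eq_inner
    by (simp add: inner_diff inner_commute power2_eq_square algebra_simps)
qed

text \<open>Rotation into the half plane does not increase distances, by the reverse triangle
  inequality for the parts orthogonal to \<open>e\<close>. The signed distance to a line is then one
  of two coordinates in a rotated orthonormal frame.\<close>

lemma height_diff_le:
  assumes "norm e = 1"
  shows "\<bar>height e \<alpha> p - height e \<alpha> q\<bar> \<le> norm (p - q)"
proof -
  define u where "u = (p - q) \<bullet> e"
  define v where "v = norm (p - (p \<bullet> e) *\<^sub>R e) - norm (q - (q \<bullet> e) *\<^sub>R e)"
  have "\<bar>v\<bar> \<le> norm ((p - (p \<bullet> e) *\<^sub>R e) - (q - (q \<bullet> e) *\<^sub>R e))"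
    unfolding v_def by (rule norm_triangle_ineq3)
  also have "\<dots> = norm ((p - q) - ((p - q) \<bullet> e) *\<^sub>R e)"
    by (simp add: inner_diff algebra_simps)
  finally have "v\<^sup>2 \<le> (norm ((p - q) - ((p - q) \<bullet> e) *\<^sub>R e))\<^sup>2"
    by (metis norm_ge_zero power2_abs power_mono abs_ge_zero)
  then have "u\<^sup>2 + v\<^sup>2 \<le> (norm (p - q))\<^sup>2"
    using norm_squared_axis[OF assms, of "p - q"] by (simp add: u_def)
  moreover have "(v * cos \<alpha> - u * sin \<alpha>)\<^sup>2 + (v * sin \<alpha> + u * cos \<alpha>)\<^sup>2 = (u\<^sup>2 + v\<^sup>2) * ((sin \<alpha>)\<^sup>2 + (cos \<alpha>)\<^sup>2)"
    by algebra
  ultimately have "(v * cos \<alpha> - u * sin \<alpha>)\<^sup>2 \<le> (norm (p - q))\<^sup>2"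
    using zero_le_power2[of "v * sin \<alpha> + u * cos \<alpha>"] by (simp only: sin_cos_squared_add mult_1_right)
  then have "\<bar>v * cos \<alpha> - u * sin \<alpha>\<bar> \<le> norm (p - q)"
    by (metis abs_le_square_iff abs_norm_cancel)
  moreover have "height e \<alpha> p - height e \<alpha> q = v * cos \<alpha> - u * sin \<alpha>"
    by (simp add: height_def u_def v_def inner_diff algebra_simps)
  ultimately show ?thesis by simp
qed

lemma height_on_ray: "on_ray e \<alpha> r p \<Longrightarrow> height e \<alpha>' p = r * sin (\<alpha> - \<alpha>')"
  unfolding on_ray_def height_def by (elim conjE) (simp only: sin_diff, simp add: algebra_simps)

lemma height_axis: "norm e = 1 \<Longrightarrow> height e \<alpha> (k *\<^sub>R e) = - k * sin \<alpha>"
  by (simp add: height_def dot_square_norm)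

text \<open>Vanishing height only gives the full line. The second half-plane coordinate is a norm,
  hence nonnegative, and \<open>sin \<alpha> > 0\<close> excludes the opposite ray.\<close>

lemma on_ray_if_height_eq_0:
  assumes "norm e = 1" "1 \<le> norm p" "0 < \<alpha>" "\<alpha> < pi" "height e \<alpha> p = 0"
  obtains r where "r \<ge> 1" "on_ray e \<alpha> r p"
proof -
  define a where "a = p \<bullet> e"
  define b where "b = norm (p - (p \<bullet> e) *\<^sub>R e)"
  \<comment> \<open>The component of \<open>(a, b)\<close> along the direction
    \<open>(cos \<alpha>, sin \<alpha>)\<close> of the ray.\<close>
  define r where "r = a * cos \<alpha> + b * sin \<alpha>"
  have "sin \<alpha> > 0" using assms by (simp add: sin_gt_zero)
  have eq: "b * cos \<alpha> = a * sin \<alpha>" using assms(5) by (simp add: height_def a_def b_def)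
  have unit: "(sin \<alpha>)\<^sup>2 + (cos \<alpha>)\<^sup>2 = 1" by simp
  have "r * cos \<alpha> = a * (cos \<alpha>)\<^sup>2 + (b * cos \<alpha>) * sin \<alpha>"
    unfolding r_def by algebra
  also have "\<dots> = a * ((sin \<alpha>)\<^sup>2 + (cos \<alpha>)\<^sup>2)" unfolding eq by algebra
  finally have ra: "a = r * cos \<alpha>" by (simp only: unit)
  have "r * sin \<alpha> = (a * sin \<alpha>) * cos \<alpha> + b * (sin \<alpha>)\<^sup>2"
    unfolding r_def by algebra
  also have "\<dots> = b * ((sin \<alpha>)\<^sup>2 + (cos \<alpha>)\<^sup>2)" unfolding eq[symmetric] by algebra
  finally have rb: "b = r * sin \<alpha>" by (simp only: unit)
  have "r \<ge> 0" using rb \<open>sin \<alpha> > 0\<close> norm_ge_zero[of "p - (p \<bullet> e) *\<^sub>R e"]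
    by (metis b_def linorder_not_le mult_neg_pos)
  have "(norm p)\<^sup>2 = a\<^sup>2 + b\<^sup>2" unfolding a_def b_def by (rule norm_squared_axis[OF assms(1)])
  also have "\<dots> = (r * cos \<alpha>)\<^sup>2 + (r * sin \<alpha>)\<^sup>2" by (simp only: ra[symmetric] rb[symmetric])
  also have "\<dots> = r\<^sup>2 * ((sin \<alpha>)\<^sup>2 + (cos \<alpha>)\<^sup>2)" by algebra
  also have "\<dots> = r\<^sup>2" by simp
  finally have "norm p = r" using \<open>r \<ge> 0\<close> by simp
  with assms(2) ra rb show ?thesis
    by (intro that[of r]) (auto simp: on_ray_def a_def b_def)
qed

section \<open>Successive crossings of rays\<close>

context
  fixes \<gamma> :: "real \<Rightarrow> 'a::real_inner" and e :: 'a and k T :: real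
  assumes lipschitz: "\<And>s t. 0 \<le> s \<Longrightarrow> s \<le> t \<Longrightarrow> norm (\<gamma> t - \<gamma> s) \<le> t - s"
    and free: "\<And>t. 0 \<le> t \<Longrightarrow> 1 \<le> norm (\<gamma> t)"
    and e: "norm e = 1" and "k \<ge> 0" and target: "\<gamma> T = k *\<^sub>R e"
begin

lemma height_curve_diff_le: "0 \<le> s \<Longrightarrow> s \<le> t \<Longrightarrow> \<bar>height e \<alpha> (\<gamma> t) - height e \<alpha> (\<gamma> s)\<bar> \<le> t - s"
  using height_diff_le[OF e] lipschitz order_trans by blast

text \<open>The height over the line at \<alpha>' starts at
  \<open>r * sin (\<alpha> - \<alpha>')\<close> and is nonpositive at the target. It vanishes in
  between, and being 1-Lipschitz it needs at least that much time.\<close>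

lemma crosses_next_ray:
  assumes "0 \<le> t" "t \<le> T" "on_ray e \<alpha> r (\<gamma> t)" "r \<ge> 1" "0 < \<alpha>'" "\<alpha>' \<le> \<alpha>" "\<alpha> \<le> pi"
  obtains t' r' where "t + r * sin (\<alpha> - \<alpha>') \<le> t'" "t' \<le> T" "r' \<ge> 1" "on_ray e \<alpha>' r' (\<gamma> t')"
\<comment> \<open>Equality is split off because it allows \<open>\<alpha>' = pi\<close>, whereas the
  argument below needs \<open>\<alpha>' < pi\<close>.\<close>
proof (cases "\<alpha>' = \<alpha>")
  case True
  then show ?thesis using assms that[of t r] by simp
next
  case False
  have "\<alpha>' < pi" using assms False by simp
  have cont: "continuous_on {t..T} (\<lambda>t. height e \<alpha>' (\<gamma> t))"
  proof (rule lipschitz_on_continuous_on, rule lipschitz_onI)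
    fix x y assume "x \<in> {t..T}" "y \<in> {t..T}"
    then show "dist (height e \<alpha>' (\<gamma> x)) (height e \<alpha>' (\<gamma> y)) \<le> 1 * dist x y"
      using height_curve_diff_le[of x y \<alpha>'] height_curve_diff_le[of y x \<alpha>'] \<open>0 \<le> t\<close>
      by (cases "x \<le> y") (auto simp: dist_real_def)
  qed simp
  have start: "height e \<alpha>' (\<gamma> t) = r * sin (\<alpha> - \<alpha>')"
    using assms(3) by (rule height_on_ray)
  have "0 \<le> height e \<alpha>' (\<gamma> t)"
    unfolding start using assms by (intro mult_nonneg_nonneg sin_ge_zero) auto
  moreover have "height e \<alpha>' (\<gamma> T) \<le> 0"
    unfolding target height_axis[OF e] using \<open>k \<ge> 0\<close> \<open>0 < \<alpha>'\<close> \<open>\<alpha>' < pi\<close>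
    by (simp add: sin_ge_zero)
  ultimately obtain t' where t': "t \<le> t'" "t' \<le> T" "height e \<alpha>' (\<gamma> t') = 0"
    using IVT2'[OF _ _ \<open>t \<le> T\<close> cont] by blast
  have "r * sin (\<alpha> - \<alpha>') \<le> t' - t"
    using height_curve_diff_le[of t t' \<alpha>'] t' \<open>0 \<le> t\<close> start by simp
  moreover obtain r' where "r' \<ge> 1" "on_ray e \<alpha>' r' (\<gamma> t')"
    using on_ray_if_height_eq_0[OF e free \<open>0 < \<alpha>'\<close> \<open>\<alpha>' < pi\<close> t'(3)] t'(1) \<open>0 \<le> t\<close> by auto
  ultimately show ?thesis using t'(2) that[of t' r'] by simp
qed

text \<open>Every crossing radius is at least 1, so each step costs at least
  \<open>sin \<Delta>\<close>, however the radii vary. The strict bound on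
  \<open>real m * \<Delta>\<close> keeps the last angle positive.\<close>

lemma crosses_many_rays:
  assumes "0 \<le> t" "t \<le> T" "on_ray e \<alpha> r (\<gamma> t)" "r \<ge> 1" "\<alpha> \<le> pi" "0 \<le> \<Delta>" "\<Delta> \<le> pi" "real m * \<Delta> < \<alpha>"
  shows "\<exists>t' r'. t + real m * sin \<Delta> \<le> t' \<and> t' \<le> T \<and> r' \<ge> 1 \<and> on_ray e (\<alpha> - real m * \<Delta>) r' (\<gamma> t')"
  using assms(8)
proof (induction m)
  case 0
  then show ?case using assms by auto
next
  case (Suc m)
  have le: "real m * \<Delta> \<le> real (Suc m) * \<Delta>" using assms(6) by (intro mult_right_mono) auto
  then obtain t1 r1 where 1: "t + real m * sin \<Delta> \<le> t1" "t1 \<le> T" "r1 \<ge> 1"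
      "on_ray e (\<alpha> - real m * \<Delta>) r1 (\<gamma> t1)"
    using Suc by auto
  have "sin \<Delta> \<ge> 0" using assms by (simp add: sin_ge_zero)
  then have "0 \<le> t1" using 1(1) \<open>0 \<le> t\<close> by (smt (verit) mult_nonneg_nonneg of_nat_0_le_iff)
  have "0 \<le> real m * \<Delta>" using assms(6) by simp
  then obtain t2 r2 where 2: "t1 + r1 * sin ((\<alpha> - real m * \<Delta>) - (\<alpha> - real (Suc m) * \<Delta>)) \<le> t2" "t2 \<le> T"
      "r2 \<ge> 1" "on_ray e (\<alpha> - real (Suc m) * \<Delta>) r2 (\<gamma> t2)"
    using crosses_next_ray[OF \<open>0 \<le> t1\<close> 1(2,4,3), of "\<alpha> - real (Suc m) * \<Delta>"] Suc.prems le \<open>\<alpha> \<le> pi\<close>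
    by auto
  have "(\<alpha> - real m * \<Delta>) - (\<alpha> - real (Suc m) * \<Delta>) = \<Delta>" by (simp add: algebra_simps)
  then have "t1 + r1 * sin \<Delta> \<le> t2" using 2(1) by simp
  moreover have "sin \<Delta> \<le> r1 * sin \<Delta>" using 1(3) \<open>sin \<Delta> \<ge> 0\<close> by (simp add: mult_le_cancel_right1)
  ultimately have "t + real (Suc m) * sin \<Delta> \<le> t2" using 1(1) by (simp add: algebra_simps)
  then show ?case using 2 by blast
qed

text \<open>With \<open>n\<close> equal pieces the arc costs at least
  \<open>n * sin (c / n)\<close>, which tends to \<open>c\<close>. From the ray at \<beta> the
  target is still at distance \<open>k * sin \<beta>\<close> from its line, which bounds the last
  leg.\<close>

lemma arc_time_le:
  assumes "0 \<le> t" "t \<le> T" "on_ray e \<alpha> r (\<gamma> t)" "r \<ge> 1" "0 < \<beta>" "\<beta> \<le> \<alpha>" "\<alpha> \<le> pi"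
  shows "t + (\<alpha> - \<beta>) + k * sin \<beta> \<le> T"
proof -
  define c where "c = \<alpha> - \<beta>"
  have bound: "t + real (Suc m) * sin (c / real (Suc m)) + k * sin \<beta> \<le> T" for m
  proof -
    have c: "0 \<le> c" "c < pi" using assms by (auto simp: c_def)
    have "c / real (Suc m) \<le> c" using c(1) by (simp add: divide_le_eq mult_le_cancel_left1)
    then obtain t' r' where t': "t + real (Suc m) * sin (c / real (Suc m)) \<le> t'" "t' \<le> T"
        "on_ray e (\<alpha> - real (Suc m) * (c / real (Suc m))) r' (\<gamma> t')"
      using crosses_many_rays[OF assms(1-4,7), of "c / real (Suc m)" "Suc m"] c assms by (auto simp: c_def)
    have "on_ray e \<beta> r' (\<gamma> t')" using t'(3) by (simp add: c_def del: of_nat_Suc)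
    then have "height e \<beta> (\<gamma> t') = 0" using height_on_ray by fastforce
    moreover have "0 \<le> sin (c / real (Suc m))"
      using c \<open>c / real (Suc m) \<le> c\<close> by (intro sin_ge_zero) auto
    then have "0 \<le> t'" using t'(1) \<open>0 \<le> t\<close> by (smt (verit) mult_nonneg_nonneg of_nat_0_le_iff)
    ultimately have "k * sin \<beta> \<le> T - t'"
      using height_curve_diff_le[OF _ t'(2), of \<beta>] by (simp add: target height_axis[OF e])
    then show ?thesis using t'(1) by simp
  qed
  have "(\<lambda>m. t + real (Suc m) * sin (c / real (Suc m)) + k * sin \<beta>) \<longlonglongrightarrow> t + c + k * sin \<beta>"
    by real_asymp
  then show ?thesis using bound unfolding c_def[symmetric]
    by (intro LIMSEQ_le_const2) auto
qed

text \<open>The first angle \<omega> is crossed in a single step, to profit from the radius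
  \<open>r\<close>. As a function of \<omega>, \<open>r * sin \<omega> - \<omega>\<close> is
  stationary where \<open>r * cos \<omega> = 1\<close>, that is, where \<omega> leads to the point
  of tangency.\<close>

lemma shadow_time_le:
  assumes "0 \<le> T" "on_ray e \<theta> r (\<gamma> 0)" "r \<ge> 1" "0 \<le> \<omega>" "0 < \<beta>" "\<beta> \<le> \<theta> - \<omega>" "\<theta> \<le> pi"
  shows "r * sin \<omega> + (\<theta> - \<omega> - \<beta>) + k * sin \<beta> \<le> T"
proof -
  obtain t' r' where t': "r * sin \<omega> \<le> t'" "t' \<le> T" "r' \<ge> 1" "on_ray e (\<theta> - \<omega>) r' (\<gamma> t')"
    using crosses_next_ray[OF _ assms(1,2,3), of "\<theta> - \<omega>"] assms by auto
  have "0 \<le> r * sin \<omega>" using assms by (intro mult_nonneg_nonneg sin_ge_zero) auto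
  then have "0 \<le> t'" using t' by simp
  from arc_time_le[OF this t'(2,4,3), of \<beta>] show ?thesis using t'(1) assms by simp
qed

end

section \<open>The distance function behind the unit ball\<close>

lemma free_region_unit_ball:
  "free_region (cball (0::'a::euclidean_space) 1) = {p. 1 \<le> norm p}"
  by (auto simp: free_region_def closure_complement simp flip: Compl_eq_Diff_UNIV)

text \<open>The fundamental theorem of calculus with finitely many exceptions makes the curve
  1-Lipschitz, so absolute continuity holds with \<open>\<delta> = \<epsilon>\<close>.\<close>

lemma admissible_curve_piecewise:
  fixes \<gamma> :: "real \<Rightarrow> 'a::banach"
  assumes free: "\<And>t. 0 \<le> t \<Longrightarrow> \<gamma> t \<in> free_region Obs"
    and cont: "continuous_on {0..} \<gamma>" and "finite S"
    and deriv: "\<And>t. 0 < t \<Longrightarrow> t \<notin> S \<Longrightarrow> \<exists>v. (\<gamma> has_vector_derivative v) (at t) \<and> norm v \<le> 1"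
  shows "\<gamma> \<in> admissible_curves Obs"
proof -
  have lip: "norm (\<gamma> t - \<gamma> s) \<le> t - s" if "0 \<le> s" "s \<le> t" for s t
  proof -
    obtain v where v: "\<And>t. 0 < t \<Longrightarrow> t \<notin> S \<Longrightarrow> (\<gamma> has_vector_derivative v t) (at t) \<and> norm (v t) \<le> 1"
      using deriv by metis
    have "(v has_integral (\<gamma> t - \<gamma> s)) {s..t}"
    proof (rule fundamental_theorem_of_calculus_interior_strong[OF \<open>finite S\<close> \<open>s \<le> t\<close>])
      show "continuous_on {s..t} \<gamma>" by (rule continuous_on_subset[OF cont]) (use that in auto)
    qed (use v that in auto)
    then have "norm (\<gamma> t - \<gamma> s) \<le> 1 * measure lborel {s..t}"
    proof (rule has_integral_bound_real[rotated 2])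
      \<comment> \<open>The endpoint \<open>s\<close> is excepted because it may be 0, where no
        derivative is assumed.\<close>
      show "finite (insert s S)" using \<open>finite S\<close> by simp
      show "norm (v u) \<le> 1" if "u \<in> {s..t} - insert s S" for u
        using that v \<open>0 \<le> s\<close> by auto
    qed simp
    then show ?thesis using that by simp
  qed
  have "absolutely_continuous_on {0..T} \<gamma>" for T
    unfolding absolutely_continuous_on_def
  proof (intro allI impI)
    fix \<epsilon> :: real assume "\<epsilon> > 0"
    have "(\<Sum>K\<in>\<D>. norm (\<gamma> (Sup K) - \<gamma> (Inf K))) < \<epsilon>"
      if \<D>: "\<D> division_of t" "t \<subseteq> {0..T}" "(\<Sum>K\<in>\<D>. Sup K - Inf K) < \<epsilon>" for \<D> t
    proof -
      have "(\<Sum>K\<in>\<D>. norm (\<gamma> (Sup K) - \<gamma> (Inf K))) \<le> (\<Sum>K\<in>\<D>. Sup K - Inf K)"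
      proof (rule sum_mono)
        fix K assume K: "K \<in> \<D>"
        then obtain u v where "K = {u..v}" using division_ofD(4)[OF \<D>(1)] by (metis box_real(2))
        moreover have "K \<noteq> {}" "K \<subseteq> {0..T}"
          using division_ofD(2,3)[OF \<D>(1) K] \<D>(2) by auto
        ultimately show "norm (\<gamma> (Sup K) - \<gamma> (Inf K)) \<le> Sup K - Inf K"
          using lip[of u v] by auto
      qed
      with \<D>(3) show ?thesis by simp
    qed
    then show "\<exists>\<delta>>0. \<forall>\<D> t. \<D> division_of t \<and> t \<subseteq> {0..T} \<and> (\<Sum>K\<in>\<D>. Sup K - Inf K) < \<delta>
        \<longrightarrow> (\<Sum>K\<in>\<D>. norm (\<gamma> (Sup K) - \<gamma> (Inf K))) < \<epsilon>"
      using \<open>\<epsilon> > 0\<close> by blast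
  qed
  moreover have "AE t in lebesgue. t \<ge> 0 \<longrightarrow>
      (\<exists>v. (\<gamma> has_vector_derivative v) (at t within {0..}) \<and> norm v \<le> 1)"
  proof -
    have "insert 0 S \<in> null_sets lebesgue"
      using \<open>finite S\<close> negligible_finite negligible_iff_null_sets by blast
    from AE_not_in[OF this] show ?thesis
    proof eventually_elim
      case (elim t)
      then show ?case
        using deriv[of t] has_vector_derivative_at_within by (cases "t = 0") fastforce+
    qed
  qed
  ultimately show ?thesis
    using free by (auto simp: admissible_curves_def locally_absolutely_continuous_def)
qed

text \<open>One curve reaching \<open>k0\<close> makes the infimum finite, so that
  \<open>real_of_ereal\<close> does not turn an infinite value into 0. The lower bound needs such a
  curve too.\<close>

lemma
  assumes "\<gamma> \<in> admissible_curves_from Obs x" "0 \<le> L" "\<gamma> L = k0"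
  shows obstacle_dist_le: "obstacle_dist Obs k0 x \<le> L"
    and obstacle_dist_ge: "(\<And>\<eta> T. \<eta> \<in> admissible_curves_from Obs x \<Longrightarrow> 0 \<le> T \<Longrightarrow> \<eta> T = k0 \<Longrightarrow> G \<le> T)
      \<Longrightarrow> G \<le> obstacle_dist Obs k0 x"
proof -
  define I where "I = (INF \<gamma>\<in>admissible_curves_from Obs x. hitting_time k0 \<gamma>)"
  have "I \<le> hitting_time k0 \<gamma>" unfolding I_def using assms(1) by (rule INF_lower)
  also have "\<dots> \<le> ereal L" unfolding hitting_time_def using assms by (intro INF_lower) auto
  finally have le: "I \<le> ereal L" .
  have "0 \<le> I" unfolding I_def hitting_time_def by (intro INF_greatest) auto
  then obtain i where i: "I = ereal i" using le by (cases I) auto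
  have dist: "obstacle_dist Obs k0 x = i" unfolding obstacle_dist_def I_def[symmetric] i by simp
  then show "obstacle_dist Obs k0 x \<le> L" using le i by simp
  show "G \<le> obstacle_dist Obs k0 x"
    if "\<And>\<eta> T. \<eta> \<in> admissible_curves_from Obs x \<Longrightarrow> 0 \<le> T \<Longrightarrow> \<eta> T = k0 \<Longrightarrow> G \<le> T"
  proof -
    have "ereal G \<le> I" unfolding I_def hitting_time_def using that by (intro INF_greatest) auto
    then show ?thesis using dist i by simp
  qed
qed

section \<open>The taut string as a shortest path\<close>

lemma norm_squared_frame:
  assumes "norm e = 1" "norm f = 1" "e \<bullet> f = 0"
  shows "(norm (a *\<^sub>R e + b *\<^sub>R f))\<^sup>2 = a\<^sup>2 + b\<^sup>2"
proof -
  have "e \<bullet> e = 1" "f \<bullet> f = 1" "f \<bullet> e = 0"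
    using assms by (simp_all add: dot_square_norm inner_commute)
  with assms show ?thesis
    unfolding power2_norm_eq_inner by (simp add: inner_add power2_eq_square)
qed

text \<open>Unit speed curve following the tangent line at angle \<open>\<beta>\<close> up to the point of tangency, the
  unit circle from angle \<open>\<beta>\<close> to \<open>\<alpha>\<close>, and then the tangent line at angle \<open>\<alpha>\<close>. The parameter is the
  angle on the circular part.\<close>

definition taut_string :: "'a::real_inner \<Rightarrow> 'a \<Rightarrow> real \<Rightarrow> real \<Rightarrow> real \<Rightarrow> 'a"
  where "taut_string e f \<beta> \<alpha> \<tau> = (let \<phi> = max \<beta> (min \<alpha> \<tau>) in
    (cos \<phi> - (\<tau> - \<phi>) * sin \<phi>) *\<^sub>R e + (sin \<phi> + (\<tau> - \<phi>) * cos \<phi>) *\<^sub>R f)"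

context
  fixes e f :: "'a::euclidean_space"
  assumes frame: "norm e = 1" "norm f = 1" "e \<bullet> f = 0"
begin

text \<open>The offset \<open>\<tau> - \<phi>\<close> is tangential, hence orthogonal to the radius
  at the contact angle \<phi>, and the squared norm is
  \<open>1 + (\<tau> - \<phi>)\<^sup>2\<close>.\<close>

lemma norm_taut_string_ge: "1 \<le> norm (taut_string e f \<beta> \<alpha> \<tau>)"
proof -
  define \<phi> where "\<phi> = max \<beta> (min \<alpha> \<tau>)"
  have "(norm (taut_string e f \<beta> \<alpha> \<tau>))\<^sup>2 = (cos \<phi> - (\<tau> - \<phi>) * sin \<phi>)\<^sup>2 + (sin \<phi> + (\<tau> - \<phi>) * cos \<phi>)\<^sup>2"
    unfolding taut_string_def Let_def \<phi>_def[symmetric] by (rule norm_squared_frame[OF frame])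
  also have "\<dots> = (1 + (\<tau> - \<phi>)\<^sup>2) * ((sin \<phi>)\<^sup>2 + (cos \<phi>)\<^sup>2)" by algebra
  also have "\<dots> \<ge> 1\<^sup>2" by simp
  finally show ?thesis by (rule power2_le_imp_le) simp
qed

lemma taut_string_vector_derivative:
  assumes "\<beta> \<le> \<alpha>" "\<tau> \<noteq> \<beta>" "\<tau> \<noteq> \<alpha>"
  shows "\<exists>v. (taut_string e f \<beta> \<alpha> has_vector_derivative v) (at \<tau>) \<and> norm v \<le> 1"
proof -
  have unit: "norm (- sin \<phi> *\<^sub>R e + cos \<phi> *\<^sub>R f) \<le> 1" for \<phi>
    using norm_squared_frame[OF frame, of "- sin \<phi>" "cos \<phi>"] by (simp add: abs_square_eq_1)
  have line: "((\<lambda>\<tau>. (cos \<phi> - (\<tau> - \<phi>) * sin \<phi>) *\<^sub>R e + (sin \<phi> + (\<tau> - \<phi>) * cos \<phi>) *\<^sub>R f)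
      has_vector_derivative (- sin \<phi> *\<^sub>R e + cos \<phi> *\<^sub>R f)) (at \<tau>)" for \<phi>
    by (auto intro!: derivative_eq_intros)
  have arc: "((\<lambda>\<tau>. cos \<tau> *\<^sub>R e + sin \<tau> *\<^sub>R f) has_vector_derivative (- sin \<tau> *\<^sub>R e + cos \<tau> *\<^sub>R f)) (at \<tau>)"
    by (auto intro!: derivative_eq_intros)
  consider "\<tau> < \<beta>" | "\<beta> < \<tau>" "\<tau> < \<alpha>" | "\<alpha> < \<tau>" using assms by linarith
  then show ?thesis
  proof cases
    case 1
    have "(taut_string e f \<beta> \<alpha> has_vector_derivative (- sin \<beta> *\<^sub>R e + cos \<beta> *\<^sub>R f)) (at \<tau>)"
      by (rule has_vector_derivative_transform_within_open[OF line[of \<beta>], of "{..<\<beta>}"])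
        (use 1 assms in \<open>auto simp: taut_string_def\<close>)
    then show ?thesis using unit by blast
  next
    case 2
    have "(taut_string e f \<beta> \<alpha> has_vector_derivative (- sin \<tau> *\<^sub>R e + cos \<tau> *\<^sub>R f)) (at \<tau>)"
      by (rule has_vector_derivative_transform_within_open[OF arc, of "{\<beta><..<\<alpha>}"])
        (use 2 assms in \<open>auto simp: taut_string_def\<close>)
    then show ?thesis using unit by blast
  next
    case 3
    have "(taut_string e f \<beta> \<alpha> has_vector_derivative (- sin \<alpha> *\<^sub>R e + cos \<alpha> *\<^sub>R f)) (at \<tau>)"
      by (rule has_vector_derivative_transform_within_open[OF line[of \<alpha>], of "{\<alpha><..}"])
        (use 3 assms in \<open>auto simp: taut_string_def\<close>)
    then show ?thesis using unit by blast
  qed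
qed

text \<open>Time is reversed: the string is parametrised by increasing angle, while the curve has to
  run from the hidden point, at the larger angle, towards \<open>k0\<close>.\<close>

lemma taut_string_admissible:
  assumes "\<beta> \<le> \<alpha>"
  shows "(\<lambda>t. taut_string e f \<beta> \<alpha> (A - t)) \<in> admissible_curves (closure (ball 0 1))"
proof (rule admissible_curve_piecewise[where S = "{A - \<beta>, A - \<alpha>}"])
  show "continuous_on {0..} (\<lambda>t. taut_string e f \<beta> \<alpha> (A - t))"
    unfolding taut_string_def Let_def by (intro continuous_intros)
  show "\<exists>v. ((\<lambda>t. taut_string e f \<beta> \<alpha> (A - t)) has_vector_derivative v) (at t) \<and> norm v \<le> 1"
    if t: "t \<notin> {A - \<beta>, A - \<alpha>}" for t
  proof -
    obtain v where v: "(taut_string e f \<beta> \<alpha> has_vector_derivative v) (at (A - t))" "norm v \<le> 1"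
      using taut_string_vector_derivative[OF assms, of "A - t"] t by auto
    have "((\<lambda>t. A - t) has_vector_derivative -1) (at t)"
      by (auto intro!: derivative_eq_intros)
    from vector_diff_chain_at[OF this v(1)] v(2) show ?thesis
      by (intro exI[of _ "- v"]) (simp add: o_def)
  qed
qed (auto simp: free_region_unit_ball norm_taut_string_ge)

text \<open>The tangent from the point with polar coordinates \<open>(r, \<theta>)\<close> touches the circle at angle \<open>\<theta> - \<omega>\<close>,
  the one from \<open>k e\<close> at angle \<open>\<beta>\<close>.\<close>

lemma obstacle_dist_behind_ball:
  assumes k: "0 \<le> k" "k * cos \<beta> = 1" and r: "1 \<le> r" "r * cos \<omega> = 1"
    and "0 < \<beta>" "0 \<le> \<omega>" "\<beta> \<le> \<theta> - \<omega>" "\<theta> \<le> pi"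
  shows "obstacle_dist (closure (ball 0 1)) (k *\<^sub>R e) (r *\<^sub>R (cos \<theta> *\<^sub>R e + sin \<theta> *\<^sub>R f))
    = r * sin \<omega> + (\<theta> - \<omega> - \<beta>) + k * sin \<beta>"
    (is "obstacle_dist ?O _ ?p = ?L")
proof (rule antisym)
  define \<alpha> where "\<alpha> = \<theta> - \<omega>"
  \<comment> \<open>At time 0 the parameter exceeds the contact angle \<alpha> by the tangent length
    \<open>r * sin \<omega>\<close>.\<close>
  define A where "A = \<alpha> + r * sin \<omega>"
  define \<gamma> where "\<gamma> t = taut_string e f \<beta> \<alpha> (A - t)" for t
  have "\<beta> \<le> \<alpha>" using assms by (simp add: \<alpha>_def)
  have pos: "0 \<le> r * sin \<omega>" "0 \<le> k * sin \<beta>"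
    using assms by (auto intro!: mult_nonneg_nonneg sin_ge_zero)
  have "\<gamma> 0 = (cos \<alpha> - r * sin \<omega> * sin \<alpha>) *\<^sub>R e + (sin \<alpha> + r * sin \<omega> * cos \<alpha>) *\<^sub>R f"
    using pos \<open>\<beta> \<le> \<alpha>\<close> by (simp add: \<gamma>_def taut_string_def A_def)
  \<comment> \<open>Writing \<open>cos \<alpha>\<close> as
    \<open>r * cos \<omega> * cos \<alpha>\<close> turns this into the addition theorem.\<close>
  also have "cos \<alpha> - r * sin \<omega> * sin \<alpha> = r * cos (\<alpha> + \<omega>)"
    unfolding cos_add using r(2) by algebra
  also have "sin \<alpha> + r * sin \<omega> * cos \<alpha> = r * sin (\<alpha> + \<omega>)"
    unfolding sin_add using r(2) by algebra
  finally have "\<gamma> 0 = ?p" by (simp add: \<alpha>_def scaleR_add_right)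
  then have from_p: "\<gamma> \<in> admissible_curves_from ?O ?p"
    using taut_string_admissible[OF \<open>\<beta> \<le> \<alpha>\<close>, of A] by (simp add: admissible_curves_from_def \<gamma>_def[abs_def])
  \<comment> \<open>At time \<open>?L\<close> the parameter lies below \<beta> by the other tangent
    length \<open>k * sin \<beta>\<close>; \<open>k * cos \<beta> = 1\<close> then cancels the
    component along \<open>f\<close>.\<close>
  have "\<gamma> ?L = taut_string e f \<beta> \<alpha> (\<beta> - k * sin \<beta>)"
    by (simp add: \<gamma>_def A_def \<alpha>_def)
  also have "\<dots> = (cos \<beta> + k * sin \<beta> * sin \<beta>) *\<^sub>R e + (sin \<beta> - k * sin \<beta> * cos \<beta>) *\<^sub>R f"
    using pos \<open>\<beta> \<le> \<alpha>\<close> by (simp add: taut_string_def)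
  also have "cos \<beta> + k * sin \<beta> * sin \<beta> = k * ((sin \<beta>)\<^sup>2 + (cos \<beta>)\<^sup>2)"
    using k(2) by algebra
  also have "sin \<beta> - k * sin \<beta> * cos \<beta> = 0"
    using k(2) by algebra
  finally have to_k: "\<gamma> ?L = k *\<^sub>R e" by simp
  have "0 \<le> ?L" using pos assms by simp
  show "obstacle_dist ?O (k *\<^sub>R e) ?p \<le> ?L"
    by (rule obstacle_dist_le[OF from_p \<open>0 \<le> ?L\<close> to_k])
  have "e \<bullet> e = 1" "f \<bullet> e = 0" using frame by (simp_all add: dot_square_norm inner_commute)
  then have pe: "?p \<bullet> e = r * cos \<theta>" by (simp add: inner_add)
  have "?p - (?p \<bullet> e) *\<^sub>R e = (r * sin \<theta>) *\<^sub>R f" unfolding pe by (simp add: scaleR_add_right)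
  moreover have "0 \<le> r * sin \<theta>" using assms by (intro mult_nonneg_nonneg sin_ge_zero) auto
  ultimately have ray: "on_ray e \<theta> r ?p" using frame pe by (simp add: on_ray_def)
  show "?L \<le> obstacle_dist ?O (k *\<^sub>R e) ?p"
  proof (rule obstacle_dist_ge[OF from_p \<open>0 \<le> ?L\<close> to_k])
    fix \<eta> T assume \<eta>: "\<eta> \<in> admissible_curves_from ?O ?p" and T: "0 \<le> T" "\<eta> T = k *\<^sub>R e"
    have "\<eta> \<in> admissible_curves ?O" "\<eta> 0 = ?p" using \<eta> by (auto simp: admissible_curves_from_def)
    then show "?L \<le> T"
      using assms T ray frame admissible_curve_norm_diff_le[OF \<open>\<eta> \<in> admissible_curves ?O\<close>]
      by (intro shadow_time_le[of \<eta> e k T \<theta> r])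
        (auto simp: admissible_curves_def free_region_unit_ball)
  qed
qed

end

section \<open>Failure of semiconcavity\<close>

lemma second_difference_growth:
  fixes \<alpha> :: real and g :: "real \<Rightarrow> real"
  defines "g \<equiv> \<lambda>s. sqrt ((1 + s)\<^sup>2 - 1) - arctan (sqrt ((1 + s)\<^sup>2 - 1))"
  assumes "\<alpha> > 1/2"
  shows "filterlim (\<lambda>t. (g (2 * t) - 2 * g t) / t powr (1 + \<alpha>)) at_top (at_right 0)"
proof -
  \<comment> \<open>From \<open>g s\<close> of order \<open>(2 * s) powr (3/2) / 3\<close>, the
    numerator has leading coefficient \<open>(4 powr (3/2) - 2 * 2 powr (3/2)) / 3\<close>. Its
    being positive is what matters.\<close>
  have "((\<lambda>t. (g (2 * t) - 2 * g t) / t powr (3/2)) \<longlongrightarrow> (8 - 4 * sqrt 2) / 3) (at_right 0)"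
    unfolding g_def by real_asymp (simp add: powr_half_sqrt)
  moreover have "4 * sqrt 2 < (8::real)"
    using real_sqrt_less_mono[of 2 4] by simp
  moreover have "filterlim (\<lambda>t. t powr (1/2 - \<alpha>)) at_top (at_right (0::real))"
    using assms by real_asymp
  ultimately have "filterlim (\<lambda>t. (g (2 * t) - 2 * g t) / t powr (3/2) * t powr (1/2 - \<alpha>)) at_top (at_right 0)"
    by (intro filterlim_tendsto_pos_mult_at_top) auto
  moreover have "(g (2 * t) - 2 * g t) / t powr (3/2) * t powr (1/2 - \<alpha>)
      = (g (2 * t) - 2 * g t) / t powr (1 + \<alpha>)" for t
    using powr_diff[of t "3/2" "1 + \<alpha>"] by (cases "t = 0") simp_all
  ultimately show ?thesis by simp
qed

lemma polar_decomposition: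
  fixes e x :: "'a::euclidean_space"
  assumes "DIM('a) \<ge> 2" "norm e = 1" "norm x = 1"
  obtains f where "norm f = 1" "e \<bullet> f = 0"
    "x = cos (arccos (x \<bullet> e)) *\<^sub>R e + sin (arccos (x \<bullet> e)) *\<^sub>R f"
proof -
  have abs: "\<bar>x \<bullet> e\<bar> \<le> 1" using Cauchy_Schwarz_ineq2[of x e] assms by simp
  then have cos: "cos (arccos (x \<bullet> e)) = x \<bullet> e" and sin: "sin (arccos (x \<bullet> e)) = sqrt (1 - (x \<bullet> e)\<^sup>2)"
    using cos_arccos_abs[OF abs] sin_arccos_abs[OF abs] by auto
  define q where "q = x - (x \<bullet> e) *\<^sub>R e"
  have "(norm q)\<^sup>2 = 1 - (x \<bullet> e)\<^sup>2"
    using norm_squared_axis[OF assms(2), of x] assms(3) by (simp add: q_def)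
  then have norm_q: "norm q = sqrt (1 - (x \<bullet> e)\<^sup>2)" by (metis norm_ge_zero real_sqrt_unique)
  have orth: "e \<bullet> q = 0"
    using assms(2) by (simp add: q_def inner_diff dot_square_norm inner_commute)
  show ?thesis
  proof (cases "q = 0")
    case True
    \<comment> \<open>Here \<open>x\<close> is \<open>e\<close> or \<open>- e\<close>, and any unit
      vector orthogonal to \<open>e\<close> serves, its coefficient being 0. Dimension at least 2
      provides one.\<close>
    obtain y where "y \<noteq> 0" "orthogonal e y" using orthogonal_to_vector_exists[OF assms(1)] by blast
    then show ?thesis using True norm_q
      by (intro that[of "sgn y"]) (auto simp: cos sin orthogonal_def sgn_div_norm q_def)
  next
    case False
    then show ?thesis using orth
      by (intro that[of "sgn q"]) (auto simp: cos sin norm_q[symmetric] sgn_div_norm, simp add: q_def)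
  qed
qed

text \<open>The origin, a point at distance \<open>c\<close> and its point of tangency form a right
  triangle with legs 1 and \<open>sqrt (c\<^sup>2 - 1)\<close> and hypotenuse
  \<open>c\<close>.\<close>

lemma tangent_angle:
  assumes "1 \<le> c"
  shows "c * cos (arctan (sqrt (c\<^sup>2 - 1))) = 1" "c * sin (arctan (sqrt (c\<^sup>2 - 1))) = sqrt (c\<^sup>2 - 1)"
proof -
  have "(sqrt (c\<^sup>2 - 1))\<^sup>2 = c\<^sup>2 - 1" using assms by simp
  then show "c * cos (arctan (sqrt (c\<^sup>2 - 1))) = 1" "c * sin (arctan (sqrt (c\<^sup>2 - 1))) = sqrt (c\<^sup>2 - 1)"
    using assms by (simp_all add: cos_arctan sin_arctan)
qed

text \<open>Only a radial segment starting at \<open>x\<close> is required of \<open>U\<close>, so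
  that both the neighbourhoods in (i) and a compact segment for (ii) are covered.\<close>

lemma obstacle_dist_not_SC:
  fixes e f :: "'a::euclidean_space" and k \<theta> :: real
  defines "x \<equiv> cos \<theta> *\<^sub>R e + sin \<theta> *\<^sub>R f"
  assumes frame: "norm e = 1" "norm f = 1" "e \<bullet> f = 0" and "1 < k"
    and \<theta>: "arctan (sqrt (k\<^sup>2 - 1)) < \<theta>" "\<theta> \<le> pi"
    and "\<alpha> > 1/2" and "s0 > 0" and U: "closed_segment x ((1 + s0) *\<^sub>R x) \<subseteq> U"
  shows "obstacle_dist (closure (ball 0 1)) (k *\<^sub>R e) \<notin> SC \<alpha> U"
proof
  define d where "d = obstacle_dist (closure (ball 0 1)) (k *\<^sub>R e)"
  define \<beta> where "\<beta> = arctan (sqrt (k\<^sup>2 - 1))"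
  define w where "w s = sqrt ((1 + s)\<^sup>2 - 1)" for s :: real
  define g where "g s = w s - arctan (w s)" for s
  assume "obstacle_dist (closure (ball 0 1)) (k *\<^sub>R e) \<in> SC \<alpha> U"
  then have "d \<in> SC \<alpha> U" by (simp only: d_def)
  then obtain C where C: "\<And>y z s. y \<in> U \<Longrightarrow> z \<in> U \<Longrightarrow> closed_segment y z \<subseteq> U \<Longrightarrow> s \<in> {0..1} \<Longrightarrow>
      s * d y + (1 - s) * d z - d (s *\<^sub>R y + (1 - s) *\<^sub>R z) \<le> C * s * (1 - s) * norm (y - z) powr (1 + \<alpha>)"
    unfolding SC_def by blast
  have "0 < \<beta>" using \<open>1 < k\<close> by (simp add: \<beta>_def zero_less_arctan_iff)
  \<comment> \<open>The condition on \<open>s\<close> says that the arc between the two points of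
    tangency has nonnegative length.\<close>
  have d: "d ((1 + s) *\<^sub>R x) = g s + (\<theta> - \<beta> + k * sin \<beta>)" if "0 \<le> s" "arctan (w s) \<le> \<theta> - \<beta>" for s
  proof -
    have "0 \<le> arctan (w s)" using \<open>0 \<le> s\<close> by (simp add: w_def zero_le_arctan_iff)
    then show ?thesis
      using obstacle_dist_behind_ball[OF frame, of k \<beta> "1 + s" "arctan (w s)" \<theta>]
        tangent_angle[of k] tangent_angle[of "1 + s"] that \<open>1 < k\<close> \<open>0 < \<beta>\<close> \<theta>(2)
      by (simp add: d_def \<beta>_def g_def w_def x_def)
  qed
  have norm_x: "norm x = 1"
    using norm_squared_frame[OF frame, of "cos \<theta>" "sin \<theta>"] by (simp add: x_def abs_square_eq_1)
  have "((\<lambda>t. arctan (w (2 * t))) \<longlongrightarrow> 0) (at_right 0)"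
    unfolding w_def by real_asymp
  then have "\<forall>\<^sub>F t in at_right 0. arctan (w (2 * t)) < \<theta> - \<beta>"
    using \<theta>(1) by (intro order_tendstoD) (auto simp: \<beta>_def)
  moreover have "\<forall>\<^sub>F t in at_right 0. 0 < t \<and> 2 * t < s0"
    using \<open>s0 > 0\<close> eventually_at_right_real[of 0 "s0 / 2"] by (auto elim: eventually_mono)
  moreover have "filterlim (\<lambda>t. (g (2 * t) - 2 * g t) / t powr (1 + \<alpha>)) at_top (at_right 0)"
    unfolding g_def w_def by (rule second_difference_growth[OF \<open>\<alpha> > 1/2\<close>])
  \<comment> \<open>The threshold is what semiconcavity with weight 1/2 on a segment of length
    \<open>2 * t\<close> yields: twice \<open>C / 4 * (2 * t) powr (1 + \<alpha>)\<close>, divided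
    by \<open>t powr (1 + \<alpha>)\<close>.\<close>
  then have "\<forall>\<^sub>F t in at_right 0. C / 2 * 2 powr (1 + \<alpha>) < (g (2 * t) - 2 * g t) / t powr (1 + \<alpha>)"
    unfolding filterlim_at_top_dense by blast
  ultimately have "\<forall>\<^sub>F t :: real in at_right 0. False"
  proof eventually_elim
    case (elim t)
    define y where "y = (1 + 2 * t) *\<^sub>R x"
    have "arctan (w t) \<le> arctan (w (2 * t))"
      unfolding w_def arctan_le_iff using elim by (intro real_sqrt_le_mono diff_right_mono power_mono) auto
    then have dt: "d ((1 + t) *\<^sub>R x) = g t + (\<theta> - \<beta> + k * sin \<beta>)"
      and d2t: "d y = g (2 * t) + (\<theta> - \<beta> + k * sin \<beta>)"
      unfolding y_def using elim by (auto intro!: d)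
    have d0: "d x = \<theta> - \<beta> + k * sin \<beta>"
      using d[of 0] \<theta>(1) by (simp add: g_def w_def \<beta>_def)
    have "(1 - 2 * t / s0) + (2 * t / s0) * (1 + s0) = 1 + 2 * t"
      using \<open>s0 > 0\<close> by (simp add: field_simps)
    then have "y = (1 - 2 * t / s0) *\<^sub>R x + (2 * t / s0) *\<^sub>R ((1 + s0) *\<^sub>R x)"
      unfolding y_def scaleR_scaleR scaleR_add_left[symmetric] by (simp only:)
    then have "y \<in> closed_segment x ((1 + s0) *\<^sub>R x)"
      unfolding in_segment using elim \<open>s0 > 0\<close> by (intro exI[of _ "2 * t / s0"] conjI) auto
    then have "closed_segment x y \<subseteq> U"
      using U by (meson ends_in_segment(1) closed_segment_subset convex_closed_segment order_trans)
    then have "1/2 * d x + (1 - 1/2) * d y - d ((1/2) *\<^sub>R x + (1 - 1/2) *\<^sub>R y)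
        \<le> C * (1/2) * (1 - 1/2) * norm (x - y) powr (1 + \<alpha>)"
      by (intro C) auto
    moreover have "(1/2) *\<^sub>R x + (1 - 1/2) *\<^sub>R y = (1 + t) *\<^sub>R x"
      by (simp add: y_def algebra_simps flip: scaleR_add_left)
    moreover have "norm (x - y) = 2 * t"
    proof -
      have "x - y = - (2 * t) *\<^sub>R x" by (simp add: y_def algebra_simps)
      then show ?thesis using norm_x elim by simp
    qed
    ultimately have "1/2 * d x + (1 - 1/2) * d y - d ((1 + t) *\<^sub>R x)
        \<le> C * (1/2) * (1 - 1/2) * (2 * t) powr (1 + \<alpha>)"
      by (simp only:)
    then have "g (2 * t) - 2 * g t \<le> C / 2 * (2 * t) powr (1 + \<alpha>)"
      unfolding dt d2t d0 by (simp add: field_simps)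
    also have "\<dots> = C / 2 * 2 powr (1 + \<alpha>) * t powr (1 + \<alpha>)"
      using elim by (simp add: powr_mult)
    finally have "(g (2 * t) - 2 * g t) / t powr (1 + \<alpha>) \<le> C / 2 * 2 powr (1 + \<alpha>)"
      using elim by (simp add: divide_le_eq)
    then show False using elim by simp
  qed
  then show False by simp
qed

text \<open>The hypothesis puts \<open>k0\<close> on or beyond the tangent hyperplane at
  \<open>x\<close>, so the straight line towards \<open>k0\<close> has
  \<open>0 \<le> x \<bullet> u\<close> and never enters the open ball.\<close>

lemma obstacle_dist_visible_le:
  fixes k0 x :: "'a::euclidean_space"
  assumes "norm x = 1" "1 \<le> x \<bullet> k0" "x \<noteq> k0"
  shows "obstacle_dist (closure (ball 0 1)) k0 x \<le> norm (x - k0)"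
proof -
  define L where "L = norm (x - k0)"
  define u where "u = (1 / L) *\<^sub>R (k0 - x)"
  \<comment> \<open>Curves live on the whole half-line, so this one runs on past
    \<open>k0\<close>.\<close>
  define \<gamma> where "\<gamma> t = x + t *\<^sub>R u" for t
  have "L > 0" using assms by (simp add: L_def)
  then have "norm u = 1" by (simp add: u_def L_def norm_minus_commute)
  have xx: "x \<bullet> x = 1" using assms by (simp add: dot_square_norm)
  then have "0 \<le> x \<bullet> u" using assms \<open>L > 0\<close> by (simp add: u_def inner_diff)
  have "1 \<le> norm (\<gamma> t)" if "0 \<le> t" for t
  proof -
    have "(norm (\<gamma> t))\<^sup>2 = 1 + 2 * t * (x \<bullet> u) + t\<^sup>2 * (norm u)\<^sup>2"
      using xx unfolding power2_norm_eq_inner \<gamma>_def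
      by (simp add: inner_add inner_commute power2_eq_square)
    also have "\<dots> \<ge> 1\<^sup>2" using \<open>0 \<le> x \<bullet> u\<close> that by simp
    finally show ?thesis by (rule power2_le_imp_le) simp
  qed
  then have "\<gamma> \<in> admissible_curves (closure (ball 0 1))"
  proof (intro admissible_curve_piecewise[where S = "{}"])
    show "continuous_on {0..} \<gamma>" unfolding \<gamma>_def by (intro continuous_intros)
    show "\<exists>v. (\<gamma> has_vector_derivative v) (at t) \<and> norm v \<le> 1" for t
      using \<open>norm u = 1\<close> by (intro exI[of _ u]) (auto simp: \<gamma>_def[abs_def] intro!: derivative_eq_intros)
  qed (auto simp: free_region_unit_ball)
  then show ?thesis
    using \<open>L > 0\<close> unfolding L_def[symmetric]
    by (intro obstacle_dist_le[of \<gamma>]) (auto simp: admissible_curves_from_def \<gamma>_def u_def)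
qed

theorem proposition1:
  fixes k0 :: "real ^ 'n" and Obs :: "(real ^ 'n) set" and d :: "real ^ 'n \<Rightarrow> real"
  assumes "CARD('n) \<ge> 2"
    and "Obs = closure (ball 0 1)"
    and "k0 \<in> UNIV - Obs"
    and "d = obstacle_dist Obs k0"
  shows "(\<forall>x \<in> shadow Obs k0 \<inter> frontier Obs. \<forall>\<delta>>0.
            d \<notin> SC 1 (closure (ball x \<delta> - Obs)))
       \<and> (\<forall>\<alpha>\<in>{0<..1}. d \<in> SC_loc \<alpha> (free_region Obs - {k0}) \<longrightarrow> \<alpha> \<le> 1 / 2)"
proof -
  define k where "k = norm k0"
  define e where "e = sgn k0"
  have "k > 1" using assms(2,3) by (simp add: k_def)
  then have "k0 \<noteq> 0" by (auto simp: k_def)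
  then have k0: "k0 = k *\<^sub>R e" by (simp add: k_def e_def sgn_div_norm)
  have e: "norm e = 1" using \<open>k0 \<noteq> 0\<close> by (simp add: e_def norm_sgn)
  have dim: "DIM(real ^ 'n) \<ge> 2" using assms(1) by simp
  define \<beta> where "\<beta> = arctan (sqrt (k\<^sup>2 - 1))"
  have not_SC: "d \<notin> SC \<alpha> U"
    if "norm x = 1" "x \<bullet> k0 < 1" "\<alpha> > 1/2" "s > 0" "closed_segment x ((1 + s) *\<^sub>R x) \<subseteq> U" for x \<alpha> s U
  proof -
    define \<theta> where "\<theta> = arccos (x \<bullet> e)"
    obtain f where f: "norm f = 1" "e \<bullet> f = 0" and x: "x = cos \<theta> *\<^sub>R e + sin \<theta> *\<^sub>R f"
      unfolding \<theta>_def using polar_decomposition[OF dim e \<open>norm x = 1\<close>] by blast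
    have abs: "\<bar>x \<bullet> e\<bar> \<le> 1" using Cauchy_Schwarz_ineq2[of x e] e that by simp
    have "0 < \<beta>" "\<beta> < pi"
      using \<open>k > 1\<close> arctan_bounded[of "sqrt (k\<^sup>2 - 1)"] by (auto simp: \<beta>_def zero_less_arctan_iff)
    \<comment> \<open>In polar form \<open>x \<bullet> k0 < 1\<close> reads
      \<open>k * cos \<theta> < 1\<close>, which places \<theta> beyond the tangency angle
      \<beta>.\<close>
    moreover have "k * cos \<theta> < k * cos \<beta>"
      using that(2) tangent_angle(1)[of k] \<open>k > 1\<close> cos_arccos_abs[OF abs] by (simp add: k0 \<theta>_def \<beta>_def)
    then have "cos \<theta> < cos \<beta>" using \<open>k > 1\<close> by simp
    moreover have "0 \<le> \<theta>" "\<theta> \<le> pi" using abs arccos_bounded[of "x \<bullet> e"] by (auto simp: \<theta>_def)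
    ultimately have "\<beta> < \<theta>" using cos_mono_less_eq[of \<theta> \<beta>] by auto
    then show ?thesis
      using obstacle_dist_not_SC[OF e f \<open>k > 1\<close> _ \<open>\<theta> \<le> pi\<close> that(3,4), of U] that(5)
      by (simp add: assms(2,4) k0 x[symmetric] \<beta>_def)
  qed
  show ?thesis
  proof (intro conjI ballI allI impI)
    fix x and \<delta> :: real assume x: "x \<in> shadow Obs k0 \<inter> frontier Obs" and "\<delta> > 0"
    have "norm x = 1" using x assms(2) by (simp add: dist_norm)
    have "x \<noteq> k0" using \<open>norm x = 1\<close> \<open>k > 1\<close> by (auto simp: k_def)
    then have "\<not> 1 \<le> x \<bullet> k0"
      using x obstacle_dist_visible_le[OF \<open>norm x = 1\<close> _ \<open>x \<noteq> k0\<close>] assms(2)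
      by (auto simp: shadow_def)
    define y where "y = (1 + \<delta>) *\<^sub>R x"
    \<comment> \<open>Both endpoints fail to lie in the set, \<open>x\<close> belonging to the
      obstacle and \<open>y\<close> having distance \<delta> from \<open>x\<close>. The closure
      restores them.\<close>
    have "open_segment x y \<subseteq> ball x \<delta> - Obs"
    proof
      fix z assume "z \<in> open_segment x y"
      then obtain u where u: "0 < u" "u < 1" "z = (1 - u) *\<^sub>R x + u *\<^sub>R y"
        by (auto simp: in_segment)
      then have z: "z = x + (u * \<delta>) *\<^sub>R x" "z = (1 + u * \<delta>) *\<^sub>R x"
        by (simp_all add: y_def algebra_simps)
      have "norm (x - z) = u * \<delta>"
        unfolding z(1) using \<open>norm x = 1\<close> u \<open>\<delta> > 0\<close> by simp
      moreover have "norm z = 1 + u * \<delta>"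
        unfolding z(2) using \<open>norm x = 1\<close> u \<open>\<delta> > 0\<close> by simp
      ultimately show "z \<in> ball x \<delta> - Obs"
        using u(2) mult_pos_pos[OF u(1) \<open>\<delta> > 0\<close>] \<open>\<delta> > 0\<close> by (simp add: assms(2) dist_norm)
    qed
    moreover have "y - x = \<delta> *\<^sub>R x" by (simp add: y_def algebra_simps)
    then have "x \<noteq> y" using \<open>norm x = 1\<close> \<open>\<delta> > 0\<close> by auto
    ultimately have "closed_segment x y \<subseteq> closure (ball x \<delta> - Obs)"
      by (metis closure_mono closure_open_segment)
    then show "d \<notin> SC 1 (closure (ball x \<delta> - Obs))"
      using \<open>\<not> 1 \<le> x \<bullet> k0\<close> \<open>norm x = 1\<close> \<open>\<delta> > 0\<close> by (intro not_SC[of x 1 \<delta>]) (auto simp: y_def)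
  next
    fix \<alpha> :: real assume \<alpha>: "\<alpha> \<in> {0<..1}" and d: "d \<in> SC_loc \<alpha> (free_region Obs - {k0})"
    \<comment> \<open>The radial segment opposite \<open>k0\<close>; its starting point satisfies
      \<open>- e \<bullet> k0 = - k < 1\<close>. The factor \<open>1 + 1\<close> is
      \<open>1 + s\<close> with \<open>s = 1\<close>.\<close>
    define K where "K = closed_segment (- e) ((1 + 1) *\<^sub>R (- e))"
    have ek: "- e \<bullet> k0 = - k" using e by (simp add: k0 dot_square_norm)
    have "K \<subseteq> free_region Obs - {k0}"
    proof
      fix z assume "z \<in> K"
      then obtain u where "0 \<le> u" and z: "z = (1 - u) *\<^sub>R (- e) + u *\<^sub>R ((1 + 1) *\<^sub>R (- e))"
        by (auto simp: K_def in_segment)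
      have z': "z = (1 + u) *\<^sub>R (- e)" unfolding z by (simp add: algebra_simps flip: scaleR_2)
      then have "norm z = 1 + u" using e \<open>0 \<le> u\<close> by simp
      \<comment> \<open>This separates \<open>z\<close> from \<open>k0\<close>: the left side is
        negative, the right side is not.\<close>
      moreover have "z \<bullet> k0 < k0 \<bullet> k0"
        unfolding z' inner_scaleR_left ek using \<open>0 \<le> u\<close> \<open>k > 1\<close>
        by (smt (verit) inner_ge_zero mult_pos_neg)
      ultimately show "z \<in> free_region Obs - {k0}"
        using \<open>0 \<le> u\<close> by (auto simp: assms(2) free_region_unit_ball)
    qed
    then have "d \<in> SC \<alpha> K" using d by (auto simp: SC_loc_def K_def)
    then show "\<alpha> \<le> 1 / 2"
      using not_SC[of "- e" \<alpha> 1 K] e ek \<open>k > 1\<close> by (force simp: K_def)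
  qed
qed

end
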